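(* Let $m,q \geq 3$, let $\zeta$ be a polarity of the projective space $\mathrm{PG}(m-1,q)$, and let $x^\ast$ be a point of $\mathrm{PG}(m-1,q)$ not contained in the hyperplane $H^\ast := (x^\ast)^\zeta$. Let $\Gamma$ be the graph with vertex set $V := \mathrm{PG}(m-1,q) \setminus (H^\ast \cup \{x^\ast\})$, in which two (possibly equal) vertices $x$ and $y$ are adjacent whenever $x \in y^\zeta$. Then $\Gamma$ is a proper LDDG whose canonical partition consists of the classes of the equivalence relation $R$ on $V$ defined by $(x,y) \in R$ if and only if $x^\ast x = x^\ast y$ (where $x^\ast x$ denotes the line through $x^\ast$ and $x$).
   Context: $\mathrm{PG}(m-1,q)$ is the projective space of the $m$-dimensional vector space $\mathbb{F}_q^m$: its points are the 1-dimensional subspaces, and a projective subspace of dimension $i$ is the set of points contained in an $(i+1)$-dimensional vector subspace; lines are subspaces of dimension 1, hyperplanes of dimension $m-2$. A polarity $\zeta$ is a bijection of the set of subspaces that reverses inclusion and satisfies $\zeta^2=\mathrm{id}$; for a point $x$, $x^\zeta$ is a hyperplane, and $x \in y^\zeta$ iff $y \in x^\zeta$. Graphs here are finite, undirected, without multiple edges, but loops are allowed: a vertex may be adjacent to itself. For a vertex $x$, $\Gamma(x)$ is the set of vertices adjacent to $x$ (containing $x$ iff $x$ has a loop), and the degree of $x$ is $|\Gamma(x)|$ (a loop contributes exactly 1). Common neighbours of $x,y$ are the elements of $\Gamma(x)\cap\Gamma(y)$. A $k$-regular graph on $v$ vertices is an LDDG with parameters $(v,k,\lambda_1,\lambda_2,m,n)$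 if its vertex set can be partitioned into $m$ classes of size $n$ such that any two distinct vertices of the same class have exactly $\lambda_1$ common neighbours and any two vertices of different classes have exactly $\lambda_2$ common neighbours. It is proper if $m,n \geq 2$ and $\lambda_1 \neq \lambda_2$; the partition is then uniquely determined and called the canonical partition. *)

theory Defs
  imports "HOL-Analysis.Analysis"
begin

section \<open>The projective space of a coordinate space\<close>

text \<open>
  The projective space of \<open>'a ^ 'm\<close> is \<open>PG(m - 1, q)\<close> for \<open>m = CARD('m)\<close> and \<open>q = CARD('a)\<close>.
  A point is a one-dimensional vector subspace, and a projective subspace is a \<^emph>\<open>set of points\<close>.
\<close>

definition pg_points :: "('a::field ^ 'm::finite) set set" where
  "pg_points = {x. vec.subspace x \<and> vec.dim x = 1}"

definition points_in :: "('a::field ^ 'm::finite) set \<Rightarrow> ('a ^ 'm) set set" where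
  "points_in W = {x \<in> pg_points. x \<subseteq> W}"

text \<open>
  The dimension is an integer, as it ranges from \<open>-1\<close> (the empty subspace) to \<open>m - 1\<close>
  (the whole space).
\<close>

definition pg_subspace :: "int \<Rightarrow> ('a::field ^ 'm::finite) set set \<Rightarrow> bool" where
  "pg_subspace i S \<longleftrightarrow>
     (\<exists>W. vec.subspace W \<and> int (vec.dim W) = i + 1 \<and> S = points_in W)"

definition pg_subspaces :: "('a::field ^ 'm::finite) set set set" where
  "pg_subspaces = {S. \<exists>i. pg_subspace i S}"

definition pg_line :: "('a::field ^ 'm::finite) set \<Rightarrow> ('a ^ 'm) set \<Rightarrow> ('a ^ 'm) set set" where
  "pg_line x y = points_in (vec.span (x \<union> y))"

text \<open>
  A point \<open>x\<close>, viewed as a projective subspace, is the singleton \<open>{x}\<close>; its image under a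
  polarity \<open>\<zeta>\<close> is therefore \<open>\<zeta> {x}\<close>. The values of \<open>\<zeta>\<close> outside \<^term>\<open>pg_subspaces\<close> are irrelevant.
\<close>

definition polarity ::
  "(('a::field ^ 'm::finite) set set \<Rightarrow> ('a ^ 'm) set set) \<Rightarrow> bool" where
  "polarity \<zeta> \<longleftrightarrow>
     bij_betw \<zeta> pg_subspaces pg_subspaces \<and>
     (\<forall>S\<in>pg_subspaces. \<forall>T\<in>pg_subspaces. S \<subseteq> T \<longrightarrow> \<zeta> T \<subseteq> \<zeta> S) \<and>
     (\<forall>S\<in>pg_subspaces. \<zeta> (\<zeta> S) = S)"

lemma pg_line_unique:
  fixes x y :: "('a::field ^ 'm::finite) set"
  assumes x: "x \<in> pg_points" and y: "y \<in> pg_points" and xy: "x \<noteq> y"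
  shows "pg_subspace 1 L \<and> x \<in> L \<and> y \<in> L \<longleftrightarrow> L = pg_line x y"
proof -
  have point: "\<exists>u. u \<noteq> 0 \<and> z = vec.span {u}" if z: "z \<in> pg_points" for z :: "('a ^ 'm) set"
  proof -
    obtain B where B: "B \<subseteq> z" "vec.independent B" "z \<subseteq> vec.span B" "card B = vec.dim z"
      using vec.basis_exists by blast
    with z obtain u where u: "B = {u}"
      by (auto simp: pg_points_def card_1_singleton_iff)
    have "vec.span B \<subseteq> z"
      using z B(1) by (intro vec.span_minimal) (auto simp: pg_points_def)
    then show ?thesis
      using u B by (auto simp: vec.dependent_single)
  qed
  obtain u where u: "u \<noteq> 0" "x = vec.span {u}" using point[OF x] by blast
  obtain v where v: "v \<noteq> 0" "y = vec.span {v}" using point[OF y] by blast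
  have span: "vec.span (x \<union> y) = vec.span {u, v}"
  proof
    have "x \<subseteq> vec.span {u, v}" "y \<subseteq> vec.span {u, v}"
      unfolding u(2) v(2) by (simp_all add: vec.span_mono)
    then show "vec.span (x \<union> y) \<subseteq> vec.span {u, v}"
      by (intro vec.span_minimal) (simp_all add: vec.subspace_span)
  next
    have "u \<in> x" "v \<in> y" unfolding u(2) v(2) by (simp_all add: vec.span_base)
    then show "vec.span {u, v} \<subseteq> vec.span (x \<union> y)"
      by (intro vec.span_mono) simp
  qed
  have "u \<notin> vec.span {v}"
  proof
    assume "u \<in> vec.span {v}"
    then have "x \<subseteq> y" unfolding u(2) v(2) by (intro vec.span_minimal) auto
    moreover have "vec.dim x = vec.dim y" using x y by (simp add: pg_points_def)
    ultimately show False
      using xy x y vec.subspace_dim_equal[of x y] by (auto simp: pg_points_def)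
  qed
  moreover from this have "u \<noteq> v" by (auto intro: vec.span_base)
  ultimately have "vec.independent {u, v}"
    using v by (simp add: vec.independent_insert vec.dependent_single)
  then have dim: "vec.dim (vec.span (x \<union> y)) = 2"
    using \<open>u \<noteq> v\<close> unfolding span by (simp add: vec.dim_eq_card_independent)
  show ?thesis
  proof
    assume L: "pg_subspace 1 L \<and> x \<in> L \<and> y \<in> L"
    then obtain W where W: "vec.subspace W" "vec.dim W = 2" "L = points_in W"
      by (auto simp: pg_subspace_def)
    have "vec.span (x \<union> y) \<subseteq> W"
      using L W by (intro vec.span_minimal) (auto simp: points_in_def)
    then have "vec.span (x \<union> y) = W"
      using W dim by (intro vec.subspace_dim_equal) auto
    then show "L = pg_line x y" using W by (simp add: pg_line_def)
  next
    assume L: "L = pg_line x y"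
    have "pg_subspace 1 L"
      unfolding pg_subspace_def L pg_line_def using dim
      by (intro exI[of _ "vec.span (x \<union> y)"]) auto
    moreover have "x \<in> L" "y \<in> L"
      using x y vec.span_superset[of "x \<union> y"] by (auto simp: L pg_line_def points_in_def)
    ultimately show "pg_subspace 1 L \<and> x \<in> L \<and> y \<in> L" by blast
  qed
qed


section \<open>Looped divisible design graphs\<close>

text \<open>
  A graph is a vertex set \<open>V\<close> with a symmetric relation \<open>E\<close> on it, not necessarily irreflexive.
  The neighbourhood of \<open>x\<close> is \<open>E `` {x}\<close>, so that a loop contributes one to the degree.
\<close>

definition looped_graph :: "'v set \<Rightarrow> 'v rel \<Rightarrow> bool" where
  "looped_graph V E \<longleftrightarrow> finite V \<and> E \<subseteq> V \<times> V \<and> sym E"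

definition common_neighbours :: "'v rel \<Rightarrow> 'v \<Rightarrow> 'v \<Rightarrow> 'v set" where
  "common_neighbours E x y = E `` {x} \<inter> E `` {y}"

definition LDDG_partition ::
  "'v set \<Rightarrow> 'v rel \<Rightarrow> nat \<Rightarrow> nat \<Rightarrow> nat \<Rightarrow> nat \<Rightarrow> 'v set set \<Rightarrow> bool" where
  "LDDG_partition V E l1 l2 m n P \<longleftrightarrow>
     partition_on V P \<and> card P = m \<and> (\<forall>C\<in>P. card C = n) \<and>
     (\<forall>C\<in>P. \<forall>x\<in>C. \<forall>y\<in>C. x \<noteq> y \<longrightarrow> card (common_neighbours E x y) = l1) \<and>
     (\<forall>C\<in>P. \<forall>D\<in>P. C \<noteq> D \<longrightarrow>
        (\<forall>x\<in>C. \<forall>y\<in>D. card (common_neighbours E x y) = l2))"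

definition LDDG ::
  "'v set \<Rightarrow> 'v rel \<Rightarrow> nat \<Rightarrow> nat \<Rightarrow> nat \<Rightarrow> nat \<Rightarrow> nat \<Rightarrow> nat \<Rightarrow> bool" where
  "LDDG V E v k l1 l2 m n \<longleftrightarrow>
     looped_graph V E \<and> card V = v \<and> (\<forall>x\<in>V. card (E `` {x}) = k) \<and>
     (\<exists>P. LDDG_partition V E l1 l2 m n P)"

definition proper_LDDG :: "'v set \<Rightarrow> 'v rel \<Rightarrow> bool" where
  "proper_LDDG V E \<longleftrightarrow>
     (\<exists>v k l1 l2 m n. LDDG V E v k l1 l2 m n \<and> m \<ge> 2 \<and> n \<ge> 2 \<and> l1 \<noteq> l2)"

definition proper_LDDG_partition :: "'v set \<Rightarrow> 'v rel \<Rightarrow> 'v set set \<Rightarrow> bool" where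
  "proper_LDDG_partition V E P \<longleftrightarrow>
     (\<exists>l1 l2 m n. LDDG_partition V E l1 l2 m n P \<and> m \<ge> 2 \<and> n \<ge> 2 \<and> l1 \<noteq> l2)"

definition canonical_partition :: "'v set \<Rightarrow> 'v rel \<Rightarrow> 'v set set" where
  "canonical_partition V E = (THE P. proper_LDDG_partition V E P)"

lemma ex_two_elements:
  assumes "card S \<ge> 2"
  shows "\<exists>x\<in>S. \<exists>y\<in>S. x \<noteq> y"
proof -
  have "finite S" using assms card.infinite by fastforce
  then show ?thesis using assms card_le_Suc0_iff_eq[of S] by auto
qed

lemma proper_LDDG_partition_subset:
  assumes P: "proper_LDDG_partition V E P" and Q: "proper_LDDG_partition V E Q"
  shows "P \<subseteq> Q"
proof
  obtain l1 l2 m n where p: "LDDG_partition V E l1 l2 m n P" "m \<ge> 2" "n \<ge> 2" "l1 \<noteq> l2"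
    using P by (auto simp: proper_LDDG_partition_def)
  obtain k1 k2 m' n' where q: "LDDG_partition V E k1 k2 m' n' Q" "k1 \<noteq> k2"
    using Q by (auto simp: proper_LDDG_partition_def)
  define c where "c x y = card (common_neighbours E x y)" for x y
  have partP: "partition_on V P" and partQ: "partition_on V Q"
    using p q by (auto simp: LDDG_partition_def)
  have coverP: "\<exists>C\<in>P. x \<in> C" and coverQ: "\<exists>C\<in>Q. x \<in> C" if "x \<in> V" for x
    using that partP partQ by (auto simp: partition_on_def)
  have disjP: "C = D" if "C \<in> P" "D \<in> P" "x \<in> C" "x \<in> D" for x C D
    using that partP by (auto simp: partition_on_def disjoint_def)
  have disjQ: "C = D" if "C \<in> Q" "D \<in> Q" "x \<in> C" "x \<in> D" for x C D
    using that partQ by (auto simp: partition_on_def disjoint_def)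
  have inV: "x \<in> V" if "C \<in> P \<union> Q" "x \<in> C" for x C
    using that partP partQ by (auto simp: partition_on_def)
  have p1: "c x y = l1" if "C \<in> P" "x \<in> C" "y \<in> C" "x \<noteq> y" for C x y
    using that p(1) unfolding LDDG_partition_def c_def by blast
  have p2: "c x y = l2" if "C \<in> P" "x \<in> C" "D \<in> P" "y \<in> D" "C \<noteq> D" for C D x y
    using that p(1) unfolding LDDG_partition_def c_def by blast
  have q1: "c x y = k1" if "C \<in> Q" "x \<in> C" "y \<in> C" "x \<noteq> y" for C x y
    using that q(1) unfolding LDDG_partition_def c_def by blast
  have q2: "c x y = k2" if "C \<in> Q" "x \<in> C" "D \<in> Q" "y \<in> D" "C \<noteq> D" for C D x y
    using that q(1) unfolding LDDG_partition_def c_def by blast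
  have "card P \<ge> 2" using p by (auto simp: LDDG_partition_def)
  then obtain A B where AB: "A \<in> P" "B \<in> P" "A \<noteq> B" using ex_two_elements by blast
  have "card A \<ge> 2" using AB p by (auto simp: LDDG_partition_def)
  then obtain a b where ab: "a \<in> A" "b \<in> A" "a \<noteq> b" using ex_two_elements by blast
  have "B \<noteq> {}" using AB partP by (auto simp: partition_on_def)
  then obtain d where "d \<in> B" by blast
  note abd = ab this
  have l: "l1 = k1 \<and> l2 = k2"
  proof -
    have ne: "a \<noteq> d" "b \<noteq> d" using AB abd disjP by blast+
    have c: "c a b = l1" "c a d = l2" "c b d = l2"
      using AB abd p1 p2 by blast+
    obtain X Y Z where X: "X \<in> Q" "a \<in> X" "Y \<in> Q" "b \<in> Y" "Z \<in> Q" "d \<in> Z"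
      using AB abd inV coverQ by (metis UnI1)
    have s: "c x y = (if S = T then k1 else k2)"
      if "S \<in> Q" "x \<in> S" "T \<in> Q" "y \<in> T" "x \<noteq> y" for S T x y
      using that q1 q2 by auto
    have "c a b = (if X = Y then k1 else k2)" "c a d = (if X = Z then k1 else k2)"
      "c b d = (if Y = Z then k1 else k2)"
      using s[OF X(1-4) abd(3)] s[OF X(1,2,5,6) ne(1)] s[OF X(3-6) ne(2)] by blast+
    then show ?thesis
      using c p(4) q(2) by (auto split: if_splits)
  qed
  fix C assume C: "C \<in> P"
  then have "C \<noteq> {}" using partP by (auto simp: partition_on_def)
  then obtain x where x: "x \<in> C" by blast
  obtain D where D: "D \<in> Q" "x \<in> D" using x C inV coverQ by (metis UnI1)
  have "y \<in> C \<longleftrightarrow> y \<in> D" for y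
  proof
    assume y: "y \<in> C"
    then obtain D' where D': "D' \<in> Q" "y \<in> D'" using C inV coverQ by blast
    show "y \<in> D"
    proof (rule ccontr)
      assume "y \<notin> D"
      then have "c x y = k2" using D D' q2 by blast
      moreover have "c x y = l1" using C x y D \<open>y \<notin> D\<close> p1 by blast
      ultimately show False using l p(4) by simp
    qed
  next
    assume y: "y \<in> D"
    then obtain C' where C': "C' \<in> P" "y \<in> C'" using D inV coverP by blast
    show "y \<in> C"
    proof (rule ccontr)
      assume "y \<notin> C"
      then have "c x y = l2" using C x C' p2 by blast
      moreover have "c x y = k1" using x D y \<open>y \<notin> C\<close> q1 by blast
      ultimately show False using l p(4) by simp
    qed
  qed
  then have "C = D" by blast
  then show "C \<in> Q" using D by simp
qed

lemma canonical_partition_eq: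
  assumes "proper_LDDG_partition V E P"
  shows "canonical_partition V E = P"
  unfolding canonical_partition_def
proof (rule the_equality)
  show "proper_LDDG_partition V E P" by (fact assms)
  fix Q assume Q: "proper_LDDG_partition V E Q"
  show "Q = P"
    using proper_LDDG_partition_subset[OF Q assms] proper_LDDG_partition_subset[OF assms Q]
    by (rule equalityI)
qed

end

theory Submission
  imports Defs
begin

text \<open>
  A polarity induces an inclusion-reversing involution \<open>P\<close> of the lattice of vector subspaces, which
  satisfies \<open>dim (P W) = m - dim W\<close> and turns joins into meets. The neighbours of a vertex \<open>x\<close> are
  the points of \<open>P x\<close> outside its hyperplane \<open>P (xs + x)\<close>. The common neighbours of \<open>x\<close> and \<open>y\<close> are
  the points of \<open>P (x + y)\<close> outside \<open>P (xs + x + y)\<close>. There are none if \<open>xs\<close> lies on the line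
  \<open>x + y\<close>; otherwise their number is \<open>q ^ (m - 3)\<close>, because a hyperplane of a \<open>d\<close>-dimensional
  subspace misses \<open>q ^ (d - 1)\<close> of its points.
\<close>

section \<open>Points and subspaces\<close>

lemma pg_pointE:
  assumes "x \<in> pg_points"
  obtains u where "u \<noteq> 0" "x = vec.span {u}"
proof -
  obtain B where B: "B \<subseteq> x" "vec.independent B" "x \<subseteq> vec.span B" "card B = vec.dim x"
    using vec.basis_exists by blast
  with assms obtain u where u: "B = {u}"
    by (auto simp: pg_points_def card_1_singleton_iff)
  have "vec.span B \<subseteq> x"
    using assms B(1) by (intro vec.span_minimal) (auto simp: pg_points_def)
  then show ?thesis
    using u B that by (auto simp: vec.dependent_single)
qed

lemma span_singleton_in_pg_points:
  assumes "u \<noteq> 0"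
  shows "vec.span {u} \<in> pg_points"
  using assms by (simp add: pg_points_def vec.dim_eq_card_independent vec.dependent_single)

lemma pg_pointsD:
  assumes "x \<in> pg_points"
  shows "vec.subspace x" "vec.dim x = 1"
  using assms by (auto simp: pg_points_def)

lemma pg_point_eq_span:
  assumes "x \<in> pg_points" "u \<in> x" "u \<noteq> 0"
  shows "x = vec.span {u}"
proof -
  have "vec.span {u} \<subseteq> x"
    using assms by (intro vec.span_minimal) (auto simp: pg_points_def)
  then have "vec.span {u} = x"
    using pg_pointsD[OF assms(1)] pg_pointsD[OF span_singleton_in_pg_points[OF assms(3)]]
    by (intro vec.subspace_dim_equal) auto
  then show ?thesis by simp
qed

lemma pg_point_subset_iff:
  assumes "x \<in> pg_points" "u \<in> x" "u \<noteq> 0" "vec.subspace W"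
  shows "x \<subseteq> W \<longleftrightarrow> u \<in> W"
  using assms pg_point_eq_span[OF assms(1-3)] vec.span_minimal[of "{u}" W] by auto

lemma pg_point_subset_point:
  assumes "x \<in> pg_points" "y \<in> pg_points" "x \<subseteq> y"
  shows "x = y"
  using assms by (intro vec.subspace_dim_equal) (auto simp: pg_points_def)

lemma points_in_point:
  assumes "x \<in> pg_points"
  shows "points_in x = {x}"
  using assms pg_point_subset_point by (auto simp: points_in_def)

lemma points_in_mono: "U \<subseteq> W \<Longrightarrow> points_in U \<subseteq> points_in W"
  by (auto simp: points_in_def)

lemma points_in_Int: "points_in (U \<inter> W) = points_in U \<inter> points_in W"
  by (auto simp: points_in_def)

text \<open>The points of \<open>W\<close> cover it up to the zero vector, and \<open>0\<close> has
  to be added only because \<open>{0}\<close> contains no point. So a vector subspace can be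
  recovered from its set of points.\<close>

lemma Union_points_in:
  assumes "vec.subspace W"
  shows "insert 0 (\<Union>(points_in W)) = W"
proof
  show "insert 0 (\<Union>(points_in W)) \<subseteq> W"
    using assms vec.subspace_0 by (auto simp: points_in_def)
  show "W \<subseteq> insert 0 (\<Union>(points_in W))"
  proof
    fix u assume u: "u \<in> W"
    show "u \<in> insert 0 (\<Union>(points_in W))"
    proof (cases "u = 0")
      case False
      have "vec.span {u} \<subseteq> W" using u assms by (intro vec.span_minimal) auto
      then have "vec.span {u} \<in> points_in W"
        using span_singleton_in_pg_points[OF False] by (auto simp: points_in_def)
      then show ?thesis by (auto intro: vec.span_base)
    qed simp
  qed
qed

lemma points_in_subset_iff:
  assumes "vec.subspace U" "vec.subspace W"
  shows "points_in U \<subseteq> points_in W \<longleftrightarrow> U \<subseteq> W"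
  using points_in_mono Union_points_in[OF assms(1)] Union_points_in[OF assms(2)]
  by (metis Union_mono insert_mono)

lemma points_in_in_pg_subspaces:
  assumes "vec.subspace W"
  shows "points_in W \<in> pg_subspaces"
  unfolding pg_subspaces_def pg_subspace_def
  \<comment> \<open>The witness is the projective dimension, one below the vector dimension and
    hence \<open>-1\<close> for \<open>W = {0}\<close>.\<close>
  using assms by (auto intro!: exI[of _ "int (vec.dim W) - 1"] exI[of _ W])

lemma pg_subspacesE:
  assumes "S \<in> pg_subspaces"
  obtains W where "vec.subspace W" "S = points_in W"
  using assms by (auto simp: pg_subspaces_def pg_subspace_def)

abbreviation subspace_join ::
  "('a::field ^ 'm::finite) set \<Rightarrow> ('a ^ 'm) set \<Rightarrow> ('a ^ 'm) set" where
  "subspace_join U W \<equiv> vec.span (U \<union> W)"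

lemma subspace_join_subset_iff:
  assumes "vec.subspace T"
  shows "subspace_join U W \<subseteq> T \<longleftrightarrow> U \<subseteq> T \<and> W \<subseteq> T"
proof
  assume "subspace_join U W \<subseteq> T"
  then show "U \<subseteq> T \<and> W \<subseteq> T" using vec.span_superset[of "U \<union> W"] by blast
next
  assume "U \<subseteq> T \<and> W \<subseteq> T"
  then show "subspace_join U W \<subseteq> T" using assms by (intro vec.span_minimal) auto
qed

lemma subset_subspace_join: "U \<subseteq> subspace_join U W" "W \<subseteq> subspace_join U W"
  using vec.span_superset[of "U \<union> W"] by blast+

text \<open>A spanning vector of \<open>x\<close> together with a basis of \<open>W\<close> is a
  basis of the join.\<close>

lemma dim_join_point:
  assumes x: "x \<in> pg_points" and W: "vec.subspace W" and "\<not> x \<subseteq> W"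
  shows "vec.dim (subspace_join x W) = vec.dim W + 1"
proof -
  obtain u where u: "u \<noteq> 0" "x = vec.span {u}" using x by (rule pg_pointE)
  then have "u \<in> x" by (simp add: vec.span_base)
  with assms u have "u \<notin> W" using pg_point_subset_iff by blast
  obtain B where B: "B \<subseteq> W" "vec.independent B" "W \<subseteq> vec.span B" "card B = vec.dim W"
    using vec.basis_exists by blast
  have WB: "W = vec.span B" using B W by (intro subset_antisym vec.span_minimal)
  have "subspace_join x W = vec.span (insert u B)"
  proof
    show "subspace_join x W \<subseteq> vec.span (insert u B)"
      unfolding subspace_join_subset_iff[OF vec.subspace_span] u(2) WB
      by (auto intro: vec.span_mono[THEN subsetD])
    show "vec.span (insert u B) \<subseteq> subspace_join x W"
      using B \<open>u \<in> x\<close> by (intro vec.span_mono) auto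
  qed
  moreover have "vec.independent (insert u B)" "u \<notin> B"
    using B \<open>u \<notin> W\<close> WB by (auto simp: vec.independent_insert)
  moreover have "finite B" using B(2) by (rule vec.finiteI_independent)
  ultimately show ?thesis using B(4) by (simp add: vec.dim_eq_card_independent)
qed

lemma dim_join_points:
  assumes "x \<in> pg_points" "y \<in> pg_points" "x \<noteq> y"
  shows "vec.dim (subspace_join x y) = 2"
  using assms dim_join_point[of x y] pg_point_subset_point pg_pointsD by fastforce

lemma join_points_eq:
  assumes "x \<in> pg_points" "y \<in> pg_points" "x \<noteq> y" "x \<subseteq> T" "y \<subseteq> T"
    and "vec.subspace T" "vec.dim T = 2"
  shows "subspace_join x y = T"
  using assms dim_join_points[OF assms(1-3)]
  by (intro vec.subspace_dim_equal) (auto simp: subspace_join_subset_iff)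

text \<open>Collinearity with \<open>z\<close> becomes an inclusion of vector subspaces, the form in
  which \<open>R\<close> is used below.\<close>

lemma pg_line_eq_iff:
  assumes "z \<in> pg_points" "x \<in> pg_points" "y \<in> pg_points" "x \<noteq> z" "y \<noteq> z"
  shows "pg_line z x = pg_line z y \<longleftrightarrow> y \<subseteq> subspace_join z x"
proof
  assume "pg_line z x = pg_line z y"
  then have "subspace_join z x = subspace_join z y"
    unfolding pg_line_def by (metis points_in_subset_iff subset_antisym subset_refl vec.subspace_span)
  then show "y \<subseteq> subspace_join z x" using subset_subspace_join(2)[of y z] by simp
next
  assume "y \<subseteq> subspace_join z x"
  then have "subspace_join z y = subspace_join z x"
    using assms dim_join_points[of z x] subset_subspace_join(1)[of z x]
    by (intro join_points_eq) auto
  then show "pg_line z x = pg_line z y" by (simp add: pg_line_def)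
qed


section \<open>Counting over a finite field\<close>

text \<open>Adjoining a vector \<open>u\<close> outside the span multiplies the cardinality by
  \<open>q\<close>: each vector of the new span is \<open>k *s u + w\<close> for exactly one scalar
  \<open>k\<close> and one \<open>w\<close> in the old span.\<close>

lemma card_span_independent:
  fixes B :: "('a::{field,finite} ^ 'm::finite) set"
  assumes "vec.independent B"
  shows "card (vec.span B) = CARD('a) ^ card B"
proof -
  have "finite B" by simp
  then show ?thesis using assms
  proof (induction B)
    case empty
    then show ?case by simp
  next
    case (insert u B)
    then have u: "u \<notin> vec.span B" and B: "vec.independent B"
      by (auto simp: vec.independent_insert)
    define f where "f = (\<lambda>(k::'a, w). k *s u + w)"
    have "inj_on f (UNIV \<times> vec.span B)"
    proof (rule inj_onI, clarify)
      fix k l v w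
      assume v: "v \<in> vec.span B" "w \<in> vec.span B" and "f (k, v) = f (l, w)"
      then have eq: "(k - l) *s u = w - v"
        by (simp add: f_def algebra_simps vec.scale_left_diff_distrib)
      then have "(k - l) *s u \<in> vec.span B" using v by (simp add: vec.span_diff)
      \<comment> \<open>For \<open>k \<noteq> l\<close> the scalar can be inverted, which would put
        \<open>u\<close> into the span of \<open>B\<close>.\<close>
      then have "inverse (k - l) *s ((k - l) *s u) \<in> vec.span B" by (rule vec.span_scale)
      then have "k = l"
        using u by (cases "k = l") (simp_all only: vec.scale_scale vec.scale_one left_inverse
            right_minus_eq not_False_eq_True)
      then show "k = l \<and> v = w" using eq by simp
    qed
    moreover have "f ` (UNIV \<times> vec.span B) = vec.span (insert u B)"
    proof -
      have "w \<in> f ` (UNIV \<times> vec.span B)" if "w - k *s u \<in> vec.span B" for w k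
        using that by (intro image_eqI[of _ _ "(k, w - k *s u)"]) (auto simp: f_def)
      moreover have "f (k, v) \<in> vec.span (insert u B)" if "v \<in> vec.span B" for k v
        using that vec.span_mono[of B "insert u B"] vec.span_base[of u "insert u B"]
        by (auto simp: f_def intro!: vec.span_add vec.span_scale)
      ultimately show ?thesis by (auto simp: vec.span_insert)
    qed
    ultimately have "card (vec.span (insert u B)) = card ((UNIV :: 'a set) \<times> vec.span B)"
      by (metis card_image)
    then show ?case using insert B by (simp add: card_cartesian_product)
  qed
qed

lemma card_subspace:
  fixes W :: "('a::{field,finite} ^ 'm::finite) set"
  assumes "vec.subspace W"
  shows "card W = CARD('a) ^ vec.dim W"
proof -
  obtain B where B: "B \<subseteq> W" "vec.independent B" "W \<subseteq> vec.span B" "card B = vec.dim W"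
    using vec.basis_exists by blast
  then have "W = vec.span B" using assms by (intro subset_antisym vec.span_minimal)
  then show ?thesis using card_span_independent[OF B(2)] B(4) by simp
qed

text \<open>The nonzero vectors of the points outside \<open>B\<close> partition
  \<open>A - B\<close>, with \<open>q - 1\<close> of them in each point. For
  \<open>d = vec.dim B\<close> there are \<open>q ^ (d + 1) - q ^ d = q ^ d * (q - 1)\<close>
  vectors to share out.\<close>

lemma card_points_in_diff:
  fixes A B :: "('a::{field,finite} ^ 'm::finite) set"
  assumes A: "vec.subspace A" and B: "vec.subspace B" and "B \<subseteq> A"
    and dim: "vec.dim A = vec.dim B + 1"
  shows "card (points_in A - points_in B) = CARD('a) ^ vec.dim B"
proof -
  let ?q = "CARD('a)" and ?S = "points_in A - points_in B"
  \<comment> \<open>A field has at least two elements, so the factor \<open>q - 1\<close> is nonzero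
    and can be cancelled at the end.\<close>
  have "card {0, 1 :: 'a} \<le> ?q" by (intro card_mono) auto
  then have q: "?q \<ge> 2" by simp
  have S: "x \<in> pg_points" "x \<subseteq> A" "\<not> x \<subseteq> B" if "x \<in> ?S" for x
    using that by (auto simp: points_in_def)
  have disj: "x = y" if "x \<in> ?S" "y \<in> ?S" "w \<in> x" "w \<in> y" "w \<noteq> 0" for x y w
    using that S pg_point_eq_span by metis
  have "A - B = (\<Union>x\<in>?S. x - {0})"
  proof
    show "A - B \<subseteq> (\<Union>x\<in>?S. x - {0})"
    proof
      fix w assume w: "w \<in> A - B"
      then have "w \<noteq> 0" using B vec.subspace_0 by blast
      then have "vec.span {w} \<in> ?S"
        using w A B span_singleton_in_pg_points[of w] pg_point_subset_iff[of "vec.span {w}" w]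
        by (auto simp: points_in_def vec.span_base)
      then show "w \<in> (\<Union>x\<in>?S. x - {0})" using \<open>w \<noteq> 0\<close> vec.span_base by blast
    qed
    show "(\<Union>x\<in>?S. x - {0}) \<subseteq> A - B"
      using S pg_point_subset_iff B by blast
  qed
  then have "card (A - B) = (\<Sum>x\<in>?S. card (x - {0}))"
    using disj by (simp only:) (rule card_UN_disjoint; auto)
  also have "\<dots> = (\<Sum>x\<in>?S. ?q - 1)"
  proof (rule sum.cong)
    fix x assume "x \<in> ?S"
    then have "vec.subspace x" "vec.dim x = 1" using S pg_pointsD by blast+
    then show "card (x - {0}) = ?q - 1"
      using card_subspace[of x] vec.subspace_0[of x] by simp
  qed simp
  finally have "card ?S * (?q - 1) = card (A - B)" by simp
  also have "\<dots> = ?q * ?q ^ vec.dim B - ?q ^ vec.dim B"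
    using assms card_subspace[OF A] card_subspace[OF B] by (simp add: card_Diff_subset)
  also have "\<dots> = ?q ^ vec.dim B * (?q - 1)"
    by (simp only: diff_mult_distrib2 mult_1_right mult.commute[of ?q])
  finally show ?thesis using q by simp
qed


section \<open>The involution of the subspace lattice\<close>

text \<open>Transports \<open>\<zeta>\<close> to vector subspaces, where spans and dimensions are at
  hand. The inserted \<open>0\<close> matters only when the image is the empty projective subspace,
  which stands for \<open>{0}\<close>.\<close>

definition subspace_polarity ::
  "(('a::field ^ 'm::finite) set set \<Rightarrow> ('a ^ 'm) set set) \<Rightarrow> ('a ^ 'm) set \<Rightarrow> ('a ^ 'm) set"
  where "subspace_polarity \<zeta> W = insert 0 (\<Union>(\<zeta> (points_in W)))"

lemma subspace_polarity:
  assumes "polarity \<zeta>" "vec.subspace W"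
  shows "vec.subspace (subspace_polarity \<zeta> W)"
    and "points_in (subspace_polarity \<zeta> W) = \<zeta> (points_in W)"
proof -
  have "\<zeta> (points_in W) \<in> pg_subspaces"
    using assms points_in_in_pg_subspaces unfolding polarity_def by (metis bij_betwE)
  then obtain U where "vec.subspace U" "\<zeta> (points_in W) = points_in U" by (rule pg_subspacesE)
  then show "vec.subspace (subspace_polarity \<zeta> W)"
    and "points_in (subspace_polarity \<zeta> W) = \<zeta> (points_in W)"
    by (simp_all add: subspace_polarity_def Union_points_in)
qed

lemma subspace_polarity_involution:
  assumes "polarity \<zeta>" "vec.subspace W"
  shows "subspace_polarity \<zeta> (subspace_polarity \<zeta> W) = W"
proof -
  have "\<zeta> (\<zeta> (points_in W)) = points_in W"
    using assms(1) points_in_in_pg_subspaces[OF assms(2)] by (simp add: polarity_def)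
  then show ?thesis
    using subspace_polarity(2)[OF assms] Union_points_in[OF assms(2)]
    by (simp add: subspace_polarity_def)
qed

lemma subspace_polarity_antimono:
  assumes "polarity \<zeta>" "vec.subspace U" "vec.subspace W" "U \<subseteq> W"
  shows "subspace_polarity \<zeta> W \<subseteq> subspace_polarity \<zeta> U"
proof -
  have "\<zeta> (points_in W) \<subseteq> \<zeta> (points_in U)"
    using assms(1) points_in_in_pg_subspaces[OF assms(2)] points_in_in_pg_subspaces[OF assms(3)]
      points_in_mono[OF assms(4)]
    by (simp add: polarity_def)
  then show ?thesis by (auto simp: subspace_polarity_def)
qed

text \<open>The map forms a Galois connection with itself: applied to
  \<open>S \<subseteq> P T\<close>, it gives \<open>T = P (P T) \<subseteq> P S\<close>.\<close>

lemma subspace_polarity_swap: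
  assumes "polarity \<zeta>" "vec.subspace U" "vec.subspace W"
  shows "U \<subseteq> subspace_polarity \<zeta> W \<longleftrightarrow> W \<subseteq> subspace_polarity \<zeta> U"
proof -
  have "T \<subseteq> subspace_polarity \<zeta> S"
    if "S \<subseteq> subspace_polarity \<zeta> T" "vec.subspace S" "vec.subspace T" for S T
    using subspace_polarity_antimono[OF assms(1) that(2) subspace_polarity(1)[OF assms(1) that(3)] that(1)]
      subspace_polarity_involution[OF assms(1) that(3)] by simp
  then show ?thesis using assms(2,3) by blast
qed

text \<open>One inclusion is antimonotonicity. For the other, swapping shows that the image of the
  intersection contains \<open>U\<close> and \<open>W\<close>, hence their join, and swapping back
  puts the intersection inside the image of the join.\<close>

lemma subspace_polarity_join:
  assumes "polarity \<zeta>" "vec.subspace U" "vec.subspace W"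
  shows "subspace_polarity \<zeta> (subspace_join U W) = subspace_polarity \<zeta> U \<inter> subspace_polarity \<zeta> W"
proof
  have "vec.subspace (subspace_join U W)" by simp
  then show "subspace_polarity \<zeta> (subspace_join U W) \<subseteq> subspace_polarity \<zeta> U \<inter> subspace_polarity \<zeta> W"
    using assms subset_subspace_join by (intro Int_greatest subspace_polarity_antimono)
  let ?T = "subspace_polarity \<zeta> U \<inter> subspace_polarity \<zeta> W"
  have T: "vec.subspace ?T" using assms subspace_polarity(1) by (intro vec.subspace_inter)
  have "U \<subseteq> subspace_polarity \<zeta> ?T" "W \<subseteq> subspace_polarity \<zeta> ?T"
    using subspace_polarity_swap[OF assms(1) _ T] assms(2,3) by auto
  then have "subspace_join U W \<subseteq> subspace_polarity \<zeta> ?T"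
    using subspace_join_subset_iff[OF subspace_polarity(1)[OF assms(1) T]] by blast
  then show "?T \<subseteq> subspace_polarity \<zeta> (subspace_join U W)"
    using subspace_polarity_swap[OF assms(1) T vec.subspace_span] by blast
qed

text \<open>An involution is injective, so a strict inclusion stays strict, and nested subspaces of
  equal dimension coincide.\<close>

lemma subspace_polarity_dim_less:
  assumes "polarity \<zeta>" "vec.subspace U" "vec.subspace W" "U \<subset> W"
  shows "vec.dim (subspace_polarity \<zeta> W) < vec.dim (subspace_polarity \<zeta> U)"
proof -
  have "subspace_polarity \<zeta> W \<subseteq> subspace_polarity \<zeta> U"
    using assms subspace_polarity_antimono by blast
  moreover have "subspace_polarity \<zeta> W \<noteq> subspace_polarity \<zeta> U"
  proof
    assume "subspace_polarity \<zeta> W = subspace_polarity \<zeta> U"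
    then show False
      using assms(4) subspace_polarity_involution[OF assms(1,2)]
        subspace_polarity_involution[OF assms(1,3)] by simp
  qed
  ultimately show ?thesis
    using vec.subspace_dim_equal[OF subspace_polarity(1)[OF assms(1,3)] subspace_polarity(1)[OF assms(1,2)]]
    by (metis not_less)
qed

lemma subspace_extend:
  assumes "vec.subspace U" "vec.subspace W" "U \<subset> W"
  obtains x where "x \<in> pg_points" "x \<subseteq> W" "\<not> x \<subseteq> U"
proof -
  obtain w where w: "w \<in> W" "w \<notin> U" using assms(3) by blast
  then have "w \<noteq> 0" using assms(1) vec.subspace_0 by blast
  then show ?thesis
    using that[of "vec.span {w}"] w assms span_singleton_in_pg_points[of w]
      pg_point_subset_iff[of "vec.span {w}" w] by (auto simp: vec.span_base)
qed

text \<open>Climbing from \<open>W\<close> to the whole space, each adjoined point raises the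
  dimension of the subspace by exactly one and lowers that of its image by at least one. The sum
  never grows on the way, and at the top it is at least \<open>m\<close>.\<close>

lemma subspace_polarity_dim_ge:
  fixes W :: "('a::field ^ 'm::finite) set"
  assumes "polarity \<zeta>" "vec.subspace W"
  shows "vec.dim (subspace_polarity \<zeta> W) + vec.dim W \<ge> CARD('m)"
  using assms(2)
proof (induction "CARD('m) - vec.dim W" arbitrary: W rule: less_induct)
  case less
  show ?case
  proof (cases "W = UNIV")
    case True
    then show ?thesis by (simp only: vec_dim_card le_add2)
  next
    case False
    then obtain x where x: "x \<in> pg_points" "\<not> x \<subseteq> W"
      using subspace_extend[of W UNIV] less.prems by (auto simp: psubset_eq)
    let ?U = "subspace_join x W"
    have d: "vec.dim ?U = vec.dim W + 1" using dim_join_point x less.prems by blast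
    have "vec.dim ?U \<le> CARD('m)"
      using vec.dim_subset[OF subset_UNIV, of ?U] by (simp only: vec_dim_card)
    then have "CARD('m) - vec.dim ?U < CARD('m) - vec.dim W" using d by linarith
    then have "vec.dim (subspace_polarity \<zeta> ?U) + vec.dim ?U \<ge> CARD('m)"
      by (rule less.hyps) (rule vec.subspace_span)
    moreover have "W \<subset> ?U" using subset_subspace_join x by blast
    then have "vec.dim (subspace_polarity \<zeta> ?U) < vec.dim (subspace_polarity \<zeta> W)"
      using assms(1) less.prems subspace_polarity_dim_less by (metis vec.subspace_span)
    ultimately show ?thesis using d by linarith
  qed
qed

text \<open>The same descent of images, begun at the zero subspace: there the sum is at most
  \<open>m\<close>, and adding a basis of \<open>W\<close> one vector at a time cannot increase
  it.\<close>

lemma subspace_polarity_dim_le: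
  fixes W :: "('a::field ^ 'm::finite) set"
  assumes "polarity \<zeta>" "vec.subspace W"
  shows "vec.dim (subspace_polarity \<zeta> W) + vec.dim W \<le> CARD('m)"
proof -
  have "vec.dim (subspace_polarity \<zeta> (vec.span B)) + card B \<le> CARD('m)"
    if "finite B" "vec.independent B" for B :: "('a ^ 'm) set"
    using that
  proof (induction B)
    case empty
    then show ?case
      using vec.dim_subset[OF subset_UNIV, of "subspace_polarity \<zeta> (vec.span {})"]
      by (simp only: vec_dim_card card.empty add_0_right)
  next
    case (insert u B)
    then have "u \<notin> vec.span B" "vec.independent B" by (auto simp: vec.independent_insert)
    then have "vec.span B \<subset> vec.span (insert u B)"
      using vec.span_mono[of B "insert u B"] vec.span_base[of u "insert u B"] by blast
    then have "vec.dim (subspace_polarity \<zeta> (vec.span (insert u B)))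
        < vec.dim (subspace_polarity \<zeta> (vec.span B))"
      using assms(1) by (intro subspace_polarity_dim_less) auto
    then show ?case using insert \<open>vec.independent B\<close> by simp
  qed
  note bound = this
  obtain B where B: "B \<subseteq> W" "vec.independent B" "W \<subseteq> vec.span B" "card B = vec.dim W"
    using vec.basis_exists by blast
  have "W = vec.span B"
    using B(1,3) vec.span_minimal[OF B(1) assms(2)] by (intro subset_antisym)
  then show ?thesis using bound[OF vec.finiteI_independent[OF B(2)] B(2)] B(4) by simp
qed

lemma subspace_polarity_dim:
  fixes W :: "('a::field ^ 'm::finite) set"
  assumes "polarity \<zeta>" "vec.subspace W"
  shows "vec.dim (subspace_polarity \<zeta> W) + vec.dim W = CARD('m)"
  using subspace_polarity_dim_ge[OF assms] subspace_polarity_dim_le[OF assms]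
  by (rule order_antisym[rotated])


section \<open>The graph\<close>

theorem theorem1p3:
  fixes \<zeta> :: "('a::{field,finite} ^ 'm::finite) set set \<Rightarrow> ('a ^ 'm) set set"
    and xs :: "('a ^ 'm) set"
    and Hs V :: "('a ^ 'm) set set"
    and E R :: "('a ^ 'm) set rel"
  assumes "CARD('m) \<ge> 3" and "CARD('a) \<ge> 3"
    and "polarity \<zeta>"
    and "xs \<in> pg_points"
    and "Hs = \<zeta> {xs}"
    and "xs \<notin> Hs"
    and "V = pg_points - (Hs \<union> {xs})"
    and "E = {(x, y) \<in> V \<times> V. x \<in> \<zeta> {y}}"
    and "R = {(x, y) \<in> V \<times> V. pg_line xs x = pg_line xs y}"
  shows "proper_LDDG V E \<and> canonical_partition V E = V // R"
proof -

  \<comment> \<open>Translation of the graph into vector subspaces\<close>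
  let ?q = "CARD('a)" and ?m = "CARD('m)"
  define P where "P = subspace_polarity \<zeta>"
  note pol = assms(3)
  note xs = assms(4)
  note sub_xs = pg_pointsD(1)[OF xs]
  have P_sub: "vec.subspace (P W)" if "vec.subspace W" for W
    using subspace_polarity(1)[OF pol that] by (simp add: P_def)
  have P_dim: "vec.dim (P W) + vec.dim W = ?m" if "vec.subspace W" for W
    using subspace_polarity_dim[OF pol that] by (simp add: P_def)
  have P_swap: "U \<subseteq> P W \<longleftrightarrow> W \<subseteq> P U" if "vec.subspace U" "vec.subspace W" for U W
    using subspace_polarity_swap[OF pol that] by (simp add: P_def)
  have P_join: "P (subspace_join U W) = P U \<inter> P W" if "vec.subspace U" "vec.subspace W" for U W
    using subspace_polarity_join[OF pol that] by (simp add: P_def)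
  have P_inv: "P (P W) = W" if "vec.subspace W" for W
    using subspace_polarity_involution[OF pol that] by (simp add: P_def)
  have \<zeta>: "\<zeta> {x} = points_in (P x)" if "x \<in> pg_points" for x
    using subspace_polarity(2)[OF pol pg_pointsD(1)[OF that]] points_in_point[OF that]
    by (simp add: P_def)
  have xs_P: "\<not> xs \<subseteq> P xs" using assms(5,6) xs by (simp add: \<zeta> points_in_def)
  have V_iff: "x \<in> V \<longleftrightarrow> x \<in> pg_points \<and> \<not> x \<subseteq> P xs \<and> x \<noteq> xs" for x
    using assms(5,7) xs by (auto simp: \<zeta> points_in_def)
  have V_point: "x \<in> pg_points" and V_sub: "vec.subspace x" and V_P: "\<not> xs \<subseteq> P x"
    and V_ne: "x \<noteq> xs" if "x \<in> V" for x
    using that V_iff pg_pointsD(1) P_swap[OF sub_xs, of x] by auto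
  have E_iff: "(x, y) \<in> E \<longleftrightarrow> x \<in> V \<and> y \<in> V \<and> y \<subseteq> P x" for x y
    using assms(8) V_point V_sub P_swap[of x y] by (auto simp: \<zeta> points_in_def)
  \<comment> \<open>The point \<open>xs\<close> is excluded already: as \<open>x\<close> lies
    outside \<open>P xs\<close>, swapping puts \<open>xs\<close> outside \<open>P x\<close>.\<close>
  have E_nbrs: "E `` {x} = points_in (P x) - points_in (P xs)" if "x \<in> V" for x
  proof (rule set_eqI)
    show "y \<in> E `` {x} \<longleftrightarrow> y \<in> points_in (P x) - points_in (P xs)" for y
      using that V_P[OF that] by (simp add: E_iff V_iff points_in_def) blast
  qed
  have R_iff: "(x, y) \<in> R \<longleftrightarrow> x \<in> V \<and> y \<in> V \<and> y \<subseteq> subspace_join xs x" for x y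
    using assms(9) pg_line_eq_iff[OF xs] V_point V_ne by blast
  \<comment> \<open>Within \<open>P W\<close> the points of \<open>P xs\<close> are those of
    \<open>P (xs + W)\<close>, whose dimension is one less because \<open>xs\<close> is not in
    \<open>W\<close>. Taking \<open>{0}\<close>, a vertex or the join of two vertices as
    \<open>W\<close> leads to the size of \<open>V\<close>, the degree and the common
    neighbours.\<close>
  have count: "card (points_in (P W) - points_in (P xs)) = ?q ^ (?m - vec.dim W - 1)"
    if W: "vec.subspace W" "\<not> xs \<subseteq> W" for W
  proof -
    let ?J = "subspace_join xs W"
    have "points_in (P W) - points_in (P xs) = points_in (P W) - points_in (P ?J)"
      unfolding P_join[OF sub_xs W(1)] points_in_Int by blast
    moreover have "vec.dim (P W) = vec.dim (P ?J) + 1" "vec.dim (P ?J) = ?m - vec.dim W - 1"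
      using P_dim[OF W(1)] P_dim[of ?J] dim_join_point[OF xs W] by auto
    moreover have "P ?J \<subseteq> P W" using W sub_xs by (auto simp: P_join)
    ultimately show ?thesis
      using W P_sub card_points_in_diff[of "P W" "P ?J"] by simp
  qed

  \<comment> \<open>Degree and common neighbours\<close>
  have graph: "looped_graph V E"
    using V_sub P_swap by (auto simp: looped_graph_def E_iff sym_def)
  have degree: "card (E `` {x}) = ?q ^ (?m - 2)" if "x \<in> V" for x
  proof -
    have "\<not> xs \<subseteq> x" using pg_point_subset_point[OF xs] that V_point V_ne by blast
    then show ?thesis
      using count[of x] that V_sub V_point pg_pointsD(2)[of x] by (simp add: E_nbrs numeral_2_eq_2)
  qed
  have common: "common_neighbours E x y = points_in (P (subspace_join x y)) - points_in (P xs)"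
    if "x \<in> V" "y \<in> V" for x y
    using that V_sub by (simp add: common_neighbours_def E_nbrs P_join points_in_Int Int_Diff) blast
  \<comment> \<open>Both sides say that the distinct points \<open>xs\<close>, \<open>x\<close> and
    \<open>y\<close> are collinear, since a two-dimensional subspace is the join of any two distinct
    points in it.\<close>
  have R_flip: "y \<subseteq> subspace_join xs x \<longleftrightarrow> xs \<subseteq> subspace_join x y"
    if "x \<in> V" "y \<in> V" "x \<noteq> y" for x y
  proof
    assume "y \<subseteq> subspace_join xs x"
    then have "subspace_join x y = subspace_join xs x"
      using that V_point V_ne xs dim_join_points[of xs x] subset_subspace_join[of x xs]
      by (intro join_points_eq) auto
    then show "xs \<subseteq> subspace_join x y" using subset_subspace_join(1)[of xs x] by simp
  next
    assume "xs \<subseteq> subspace_join x y"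
    then have "subspace_join xs x = subspace_join x y"
      using that V_point V_ne xs dim_join_points[of x y] subset_subspace_join[of x y]
      by (intro join_points_eq) auto
    then show "y \<subseteq> subspace_join xs x" using subset_subspace_join(2)[of y x] by simp
  qed
  have same: "card (common_neighbours E x y) = 0" if "(x, y) \<in> R" "x \<noteq> y" for x y
  proof -
    have xy: "x \<in> V" "y \<in> V" "xs \<subseteq> subspace_join x y"
      using that R_iff[of x y] R_flip[of x y] by simp_all
    \<comment> \<open>The hyperplane \<open>P xs\<close> contains all of \<open>P (x + y)\<close>,
      so its removal leaves nothing.\<close>
    then have "P (subspace_join x y) \<subseteq> P xs"
      using P_swap[of "P (subspace_join x y)" xs] P_inv[of "subspace_join x y"] P_sub sub_xs by simp
    then have "common_neighbours E x y = {}"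
      using common[OF xy(1,2)] points_in_mono[of "P (subspace_join x y)" "P xs"] by simp
    then show ?thesis by simp
  qed
  have diff: "card (common_neighbours E x y) = ?q ^ (?m - 3)"
    if "x \<in> V" "y \<in> V" "x \<noteq> y" "(x, y) \<notin> R" for x y
  proof -
    have "\<not> xs \<subseteq> subspace_join x y" using that R_iff[of x y] R_flip[of x y] by simp
    moreover have "vec.dim (subspace_join x y) = 2"
      using that V_point by (intro dim_join_points) auto
    ultimately show ?thesis using that count[of "subspace_join x y"] by (simp add: common numeral_3_eq_3)
  qed

  \<comment> \<open>Size and number of the classes\<close>
  have equiv: "equiv V R"
    unfolding equiv_def refl_on_def sym_def trans_def using assms(9) by auto
  \<comment> \<open>The class of \<open>x\<close> is the line through \<open>xs\<close> and
    \<open>x\<close> without \<open>xs\<close> and without its point on the hyperplane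
    \<open>P xs\<close>, which leaves \<open>(q + 1) - 2\<close> points.\<close>
  have class_card: "card (R `` {x}) = ?q - 1" if "x \<in> V" for x
  proof -
    let ?L = "subspace_join xs x"
    let ?M = "?L \<inter> P xs"
    have L: "vec.subspace ?L" "vec.dim ?L = 2"
      using that xs V_point V_ne dim_join_points[of xs x] by auto
    have "xs \<subseteq> ?L" by (rule subset_subspace_join)
    have PL: "vec.subspace (P ?L)" "vec.dim (P ?L) + 2 = ?m"
      using P_sub[of ?L] P_dim[of ?L] L by auto
    \<comment> \<open>That \<open>?M\<close> is a single point follows by duality: it is the image
      of \<open>xs + P ?L\<close>, which has dimension \<open>m - 1\<close> because
      \<open>P ?L\<close> has dimension \<open>m - 2\<close> and does not contain
      \<open>xs\<close>.\<close>
    have "\<not> xs \<subseteq> P ?L" using that V_P sub_xs V_sub by (simp add: P_join)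
    then have "vec.dim (subspace_join xs (P ?L)) + 1 = ?m"
      using dim_join_point[OF xs PL(1)] PL(2) by simp
    moreover have "P (subspace_join xs (P ?L)) = ?M"
      using P_join[OF sub_xs PL(1)] P_inv[OF L(1)] by blast
    ultimately have "vec.dim ?M = 1" using P_dim[of "subspace_join xs (P ?L)"] by simp
    moreover have "vec.subspace ?M" using L(1) P_sub[OF sub_xs] by (rule vec.subspace_inter)
    ultimately have "card (points_in ?L - points_in ?M) = ?q"
      using card_points_in_diff[of ?L ?M] L by simp
    moreover have "R `` {x} = points_in ?L - points_in ?M - {xs}"
      using that by (auto simp: R_iff V_iff points_in_def)
    moreover have "xs \<in> points_in ?L - points_in ?M"
      using xs xs_P \<open>xs \<subseteq> ?L\<close> by (simp add: points_in_def)
    ultimately show ?thesis by simp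
  qed
  have class_card': "card C = ?q - 1" if "C \<in> V // R" for C
    using that class_card by (auto elim: quotientE)
  have part: "partition_on V (V // R)" using equiv by (rule partition_on_quotient)

  have "card V = ?q ^ (?m - 1) - 1"
  proof -
    \<comment> \<open>With \<open>W = {0}\<close>, \<open>count\<close> yields all points off the
      hyperplane, which are the vertices and \<open>xs\<close>.\<close>
    have "card (points_in (P {0}) - points_in (P xs)) = ?q ^ (?m - 1)"
      using count[of "{0}"] pg_pointsD(2)[OF xs] vec.dim_eq_0[of xs] by simp
    moreover have "P {0} = UNIV"
      using P_swap[of UNIV "{0}"] P_sub[of UNIV] vec.subspace_0[of "P UNIV"] by auto
    moreover have "V = points_in UNIV - points_in (P xs) - {xs}"
      by (auto simp: V_iff points_in_def)
    moreover have "xs \<in> points_in UNIV - points_in (P xs)"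
      using xs xs_P by (simp add: points_in_def)
    ultimately show ?thesis by simp
  qed
  \<comment> \<open>Here \<open>m \<ge> 3\<close> enters: \<open>V\<close> has at least
    \<open>q ^ 2 - 1\<close> vertices, more than the \<open>q - 1\<close> of a single class.\<close>
  moreover have "?q ^ 2 \<le> ?q ^ (?m - 1)" using assms(1,2) by (intro power_increasing) auto
  moreover have "?q < ?q ^ 2" using assms(2) by (simp add: power2_eq_square)
  ultimately have V_large: "card V > ?q - 1" using assms(2) by linarith
  have "card V = card (V // R) * (?q - 1)"
  proof -
    have "card V = (\<Sum>C\<in>V // R. card C)"
      using part card_Union_disjoint[of "V // R"]
      by (simp add: partition_on_def disjoint_def pairwise_def disjnt_def)
    then show ?thesis using class_card' by simp
  qed
  \<comment> \<open>With no class \<open>V\<close> would be empty, and with one class it would have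
    only \<open>q - 1\<close> elements.\<close>
  with V_large have classes: "card (V // R) \<ge> 2"
    by (cases "card (V // R)"; cases "card (V // R) - 1") auto

  \<comment> \<open>The design property and the canonical partition\<close>
  have "LDDG_partition V E 0 (?q ^ (?m - 3)) (card (V // R)) (?q - 1) (V // R)"
    unfolding LDDG_partition_def
  proof (intro conjI ballI impI)
    fix C x y assume "C \<in> V // R" "x \<in> C" "y \<in> C" "x \<noteq> y"
    then show "card (common_neighbours E x y) = 0"
      using same quotient_eq_iff[OF equiv] by blast
  next
    fix C D x y assume CD: "C \<in> V // R" "D \<in> V // R" "C \<noteq> D" "x \<in> C" "y \<in> D"
    then have "(x, y) \<notin> R" using quotient_eq_iff[OF equiv] by blast
    moreover have "x \<in> V" "y \<in> V" using CD part by (auto simp: partition_on_def)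
    \<comment> \<open>Reflexivity and \<open>(x, y) \<notin> R\<close> give
      \<open>x \<noteq> y\<close>, which \<open>diff\<close> requires.\<close>
    moreover have "(x, x) \<in> R" using \<open>x \<in> V\<close> equiv by (simp add: equiv_def refl_on_def)
    ultimately show "card (common_neighbours E x y) = ?q ^ (?m - 3)" using diff by blast
  qed (use part class_card' in auto)
  \<comment> \<open>A power of \<open>q\<close> is nonzero, so the two parameters differ; classes
    have at least two vertices because \<open>q \<ge> 3\<close>.\<close>
  moreover have "0 \<noteq> ?q ^ (?m - 3)" "?q - 1 \<ge> 2" using assms(2) by auto
  ultimately have "proper_LDDG V E" "proper_LDDG_partition V E (V // R)"
    using graph degree classes unfolding proper_LDDG_def proper_LDDG_partition_def LDDG_def
    by blast+
  then show ?thesis using canonical_partition_eq by blast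
qed

end
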